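(* Let $\mathcal P$ be a (constant-free) non-symmetric categorical operad with unit $e\in\mathcal P_1$. There is a strict factorization system $(\mathtt E,\mathtt M)$ on (the underlying category of) $\int\mathcal P$ given by $$[f;a_1,\dots,a_k;\alpha]=[f;a_1,\dots,a_k;1]\circ[1;e,\dots,e;\alpha].$$ Here the subcategory $\mathtt E$ consists of the morphisms $[f;a_1,\dots,a_k;\alpha]$ in which $f$ is an identity and all $a_i$ are equal to the operad unit $e$, and $\mathtt M$ consists of the morphisms $[f;a_1,\dots,a_k;\alpha]$ in which $\alpha$ is an identity.
   Context: **The category $\Delta_s$.** Objects: ordinals $\underline{n}=\{1<\dots<n\}$, $n\ge 1$; morphisms: order-preserving surjections. For $g:\underline{k}\to\underline{n}$ and $i\in\underline n$ the preimage $g^{-1}(i)$ is identified with an ordinal $\underline{k_i}$. For $\underline m\xrightarrow{f}\underline k\xrightarrow{g}\underline n$ let $f^i:(gf)^{-1}(i)\to g^{-1}(i)$ be the induced map. A sequence $a_1,\dots,a_k$ indexed by $\underline k$ is cut by $g$ into blocks $a^i_1,\dots,a^i_{k_i}$, $1\le i\le n$. $!_n:\underline n\to\underline 1$ is the unique map. **Operads.** A constant-free non-symmetric categorical operad $\mathcal P$ is a collection of categories $\{\mathcal P_n\}_{n\ge1}$ with functors $\mu_g:\mathcal P_n\times\mathcal P_{k_1}\times\dots\times\mathcal P_{k_n}\to\mathcal P_k$ for each $g:\underline k\to\underline n$ in $\Delta_s$ (with $\underline{k_i}=g^{-1}(i)$) and an object $e\in\mathcal P_1$ (the unit), such that, strictly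 (on objects and morphisms), $\mu_f(\mu_g(c,b_1,\dots,b_n),a_1,\dots,a_k)=\mu_{gf}(c,\mu_{f^1}(b_1,a^1_1,\dots,a^1_{k_1}),\dots,\mu_{f^n}(b_n,a^n_1,\dots,a^n_{k_n}))$ for all composable $f:\underline m\to\underline k$, $g:\underline k\to\underline n$, and $\mu_{1_{\underline n}}(a,e,\dots,e)=a$, $\mu_{!_n}(e,a)=a$. **Integration.** The 2-category $\int\mathcal P$ has as 0-cells pairs $[m,a]$ with $m\ge1$, $a\in\mathcal P_m$; as 1-cells $[m,a]\to[k,b]$ tuples $[f;a_1,\dots,a_k;\alpha]$ with $f:\underline m\to\underline k$ in $\Delta_s$, $a_i\in\mathcal P_{f^{-1}(i)}$, and $\alpha:\mu_f(b,a_1,\dots,a_k)\to a$ in $\mathcal P_m$. Composition of 1-cells: $[g;b_1,\dots,b_n;\beta]\circ[f;a_1,\dots,a_k;\alpha]=[gf;\mu_{f^1}(b_1,a^1_1,\dots,a^1_{k_1}),\dots,\mu_{f^n}(b_n,a^n_1,\dots,a^n_{k_n});\alpha\circ\mu_f(\beta,a_1,\dots,a_k)]$; the identity of $[m,a]$ is $[1_{\underline m};e,\dots,e;1_a]$. (The 2-cells play no role in this statement.) **Strict factorization system.** A strict factorization system on a category $\mathcal C$ is a pair of wide subcategories $\mathtt E,\mathtt M$ of $\mathcal C$ such that every morphism $f$ of $\mathcal C$ factors uniquely as $f=m\circ e$ with $m\in\mathtt M$ and $e\in\mathtt E$. *)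

theory Defs
  imports Main "HOL-Library.FuncSet"
begin

section \<open>Categories, functors, products\<close>

record ('o, 'a) cat =
  Ob :: "'o set"
  Arr :: "'a set"
  Dom :: "'a \<Rightarrow> 'o"
  Cod :: "'a \<Rightarrow> 'o"
  Id :: "'o \<Rightarrow> 'a"
  Comp :: "'a \<Rightarrow> 'a \<Rightarrow> 'a"  \<comment> \<open>\<open>Comp C g f\<close> is \<open>g\<close> after \<open>f\<close>\<close>

definition Hom :: "('o, 'a) cat \<Rightarrow> 'o \<Rightarrow> 'o \<Rightarrow> 'a set" where
  "Hom C x y = {f \<in> Arr C. Dom C f = x \<and> Cod C f = y}"

locale category =
  fixes C :: "('o, 'a) cat"
  assumes Dom_Ob: "f \<in> Arr C \<Longrightarrow> Dom C f \<in> Ob C"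
    and Cod_Ob: "f \<in> Arr C \<Longrightarrow> Cod C f \<in> Ob C"
    and Id_Hom: "x \<in> Ob C \<Longrightarrow> Id C x \<in> Hom C x x"
    and Comp_Hom: "f \<in> Hom C x y \<Longrightarrow> g \<in> Hom C y z \<Longrightarrow> Comp C g f \<in> Hom C x z"
    and Comp_Id: "f \<in> Hom C x y \<Longrightarrow> Comp C f (Id C x) = f"
    and Id_Comp: "f \<in> Hom C x y \<Longrightarrow> Comp C (Id C y) f = f"
    and Comp_assoc: "f \<in> Hom C x y \<Longrightarrow> g \<in> Hom C y z \<Longrightarrow> h \<in> Hom C z w \<Longrightarrow>
      Comp C h (Comp C g f) = Comp C (Comp C h g) f"

locale cat_functor = source: category C + target: category D
  for C :: "('o, 'a) cat" and D :: "('p, 'b) cat" +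
  fixes FO :: "'o \<Rightarrow> 'p" and FA :: "'a \<Rightarrow> 'b"
  assumes FO_Ob: "x \<in> Ob C \<Longrightarrow> FO x \<in> Ob D"
    and FA_Hom: "f \<in> Hom C x y \<Longrightarrow> FA f \<in> Hom D (FO x) (FO y)"
    and FA_Id: "x \<in> Ob C \<Longrightarrow> FA (Id C x) = Id D (FO x)"
    and FA_Comp: "f \<in> Hom C x y \<Longrightarrow> g \<in> Hom C y z \<Longrightarrow>
      FA (Comp C g f) = Comp D (FA g) (FA f)"

definition prod_cat :: "('o, 'a) cat \<Rightarrow> ('p, 'b) cat \<Rightarrow> ('o \<times> 'p, 'a \<times> 'b) cat" where
  "prod_cat C D = \<lparr>
     Ob = Ob C \<times> Ob D,
     Arr = Arr C \<times> Arr D,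
     Dom = map_prod (Dom C) (Dom D),
     Cod = map_prod (Cod C) (Cod D),
     Id = map_prod (Id C) (Id D),
     Comp = (\<lambda>(g, g') (f, f'). (Comp C g f, Comp D g' f')) \<rparr>"

definition family_cat :: "'i set \<Rightarrow> ('i \<Rightarrow> ('o, 'a) cat) \<Rightarrow> ('i \<Rightarrow> 'o, 'i \<Rightarrow> 'a) cat" where
  "family_cat I C = \<lparr>
     Ob = (\<Pi>\<^sub>E i\<in>I. Ob (C i)),
     Arr = (\<Pi>\<^sub>E i\<in>I. Arr (C i)),
     Dom = (\<lambda>f. (\<lambda>i\<in>I. Dom (C i) (f i))),
     Cod = (\<lambda>f. (\<lambda>i\<in>I. Cod (C i) (f i))),
     Id = (\<lambda>x. (\<lambda>i\<in>I. Id (C i) (x i))),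
     Comp = (\<lambda>g f. (\<lambda>i\<in>I. Comp (C i) (g i) (f i))) \<rparr>"

definition wide_subcategory :: "('o, 'a) cat \<Rightarrow> 'a set \<Rightarrow> bool" where
  "wide_subcategory C S \<longleftrightarrow> S \<subseteq> Arr C \<and> (\<forall>x \<in> Ob C. Id C x \<in> S) \<and>
     (\<forall>f \<in> S. \<forall>g \<in> S. Cod C f = Dom C g \<longrightarrow> Comp C g f \<in> S)"

definition strict_factorization_system ::
    "('o, 'a) cat \<Rightarrow> 'a set \<Rightarrow> 'a set \<Rightarrow> bool" where
  "strict_factorization_system C E M \<longleftrightarrow>
     category C \<and> wide_subcategory C E \<and> wide_subcategory C M \<and>
     (\<forall>f \<in> Arr C. \<exists>!(p, q). p \<in> E \<and> q \<in> M \<and> Cod C p = Dom C q \<and> f = Comp C q p)"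


section \<open>Order-preserving surjections of finite ordinals\<close>

text \<open>
  The ordinal \<open>n\<close> is \<open>{1..n}\<close>. Maps and sequences indexed by it are extensional functions,
  so that equality of functions is equality of maps and sequences.
\<close>

definition surjections :: "nat \<Rightarrow> nat \<Rightarrow> (nat \<Rightarrow> nat) set" where
  "surjections k n = {g \<in> {1..k} \<rightarrow>\<^sub>E {1..n}. mono_on {1..k} g \<and> g ` {1..k} = {1..n}}"

definition ord_id :: "nat \<Rightarrow> nat \<Rightarrow> nat" where
  "ord_id n = (\<lambda>i\<in>{1..n}. i)"

definition ord_bang :: "nat \<Rightarrow> nat \<Rightarrow> nat" where
  "ord_bang n = (\<lambda>i\<in>{1..n}. 1)"

definition fibre :: "nat \<Rightarrow> (nat \<Rightarrow> nat) \<Rightarrow> nat \<Rightarrow> nat set" where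
  "fibre k g i = {j \<in> {1..k}. g j = i}"

definition fibre_size :: "nat \<Rightarrow> (nat \<Rightarrow> nat) \<Rightarrow> nat \<Rightarrow> nat" where
  "fibre_size k g i = card (fibre k g i)"

text \<open>
  The fibre over \<open>i\<close> of an order-preserving map is an interval, and its order isomorphism with
  \<open>{1..fibre_size k g i}\<close> is the translation by the following offset (see \<open>fibre_shift\<close>).
\<close>

definition offset :: "nat \<Rightarrow> (nat \<Rightarrow> nat) \<Rightarrow> nat \<Rightarrow> nat" where
  "offset k g i = card {j \<in> {1..k}. g j < i}"

definition block :: "nat \<Rightarrow> (nat \<Rightarrow> nat) \<Rightarrow> (nat \<Rightarrow> 'x) \<Rightarrow> nat \<Rightarrow> nat \<Rightarrow> 'x" where
  "block k g a i = (\<lambda>j\<in>{1..fibre_size k g i}. a (offset k g i + j))"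

text \<open>
  For \<open>f\<close> from \<open>m\<close> to \<open>k\<close> and \<open>g\<close> on \<open>k\<close>, the map induced by \<open>f\<close> from the fibre of \<open>g \<circ> f\<close>
  over \<open>i\<close> to the fibre of \<open>g\<close> over \<open>i\<close>, with both fibres identified with ordinals.
\<close>

definition induced ::
    "nat \<Rightarrow> nat \<Rightarrow> (nat \<Rightarrow> nat) \<Rightarrow> (nat \<Rightarrow> nat) \<Rightarrow> nat \<Rightarrow> nat \<Rightarrow> nat" where
  "induced m k f g i =
     (let gf = compose {1..m} g f in
      (\<lambda>j\<in>{1..fibre_size m gf i}. f (offset m gf i + j) - offset k g i))"

lemma fibre_shift:
  assumes "mono_on {1..k} g"
  shows "bij_betw (\<lambda>j. offset k g i + j) {1..fibre_size k g i} (fibre k g i)"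
proof -
  define A where "A = {j \<in> {1..k}. g j < i}"
  define B where "B = {j \<in> {1..k}. g j \<le> i}"
  have initial: "S = {1..card S}"
    if S: "S \<subseteq> {1..k}" and down: "\<And>j j'. j \<in> S \<Longrightarrow> 1 \<le> j' \<Longrightarrow> j' \<le> j \<Longrightarrow> j' \<in> S" for S
  proof (cases "S = {}")
    case False
    have fin: "finite S" using S finite_subset by blast
    have "S = {1..Max S}"
    proof (intro set_eqI iffI)
      fix j assume "j \<in> S"
      then show "j \<in> {1..Max S}" using S fin by auto
    next
      fix j assume "j \<in> {1..Max S}"
      then show "j \<in> S" using down[OF Max_in[OF fin False]] by auto
    qed
    then have "card S = Max S" by (metis card_atLeastAtMost diff_Suc_1)
    with \<open>S = {1..Max S}\<close> show ?thesis by simp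
  qed simp
  have le: "g j' \<le> g j" if "j \<in> {1..k}" "1 \<le> j'" "j' \<le> j" for j j'
    using mono_onD[OF assms, of j' j] that by auto
  have A: "A = {1..card A}"
  proof (rule initial)
    show "A \<subseteq> {1..k}" by (auto simp: A_def)
    show "j' \<in> A" if "j \<in> A" "1 \<le> j'" "j' \<le> j" for j j'
      using that le[of j j'] unfolding A_def by simp
  qed
  have B: "B = {1..card B}"
  proof (rule initial)
    show "B \<subseteq> {1..k}" by (auto simp: B_def)
    show "j' \<in> B" if "j \<in> B" "1 \<le> j'" "j' \<le> j" for j j'
      using that le[of j j'] unfolding B_def by simp
  qed
  have fibre: "fibre k g i = B - A" and AB: "A \<subseteq> B" "finite A"
    by (auto simp: fibre_def A_def B_def)
  have "card (fibre k g i) = card B - card A"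
    using fibre AB by (simp add: card_Diff_subset)
  moreover have "card A \<le> card B"
    using AB by (simp add: B_def card_mono)
  moreover have "{1..card B} - {1..card A} = {card A + 1..card B}"
    by auto
  then have "B - A = {card A + 1..card B}" using A B by metis
  ultimately have "fibre k g i = {card A + 1..card A + fibre_size k g i}"
    using fibre by (simp add: fibre_size_def)
  also have "\<dots> = (\<lambda>j. card A + j) ` {1..fibre_size k g i}"
    by simp
  finally show ?thesis
    by (simp add: bij_betw_def offset_def A_def)
qed

lemma induced_shift:
  assumes f: "f \<in> surjections m k" and g: "g \<in> surjections k n"
    and j: "j \<in> {1..fibre_size m (compose {1..m} g f) i}"
  shows "induced m k f g i j \<in> {1..fibre_size k g i}"
    and "offset k g i + induced m k f g i j = f (offset m (compose {1..m} g f) i + j)"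
proof -
  let ?gf = "compose {1..m} g f"
  have f1: "\<And>x. x \<in> {1..m} \<Longrightarrow> f x \<in> {1..k}"
    using f by (auto simp: surjections_def)
  have gm: "mono_on {1..k} g" and fm: "mono_on {1..m} f"
    using f g by (auto simp: surjections_def)
  have "mono_on {1..m} ?gf"
    using mono_onD[OF gm] mono_onD[OF fm] f1 by (auto intro!: mono_onI simp: compose_def)
  from bij_betwE[OF fibre_shift[OF this, of i]] j
  have "offset m ?gf i + j \<in> fibre m ?gf i" by blast
  then have "f (offset m ?gf i + j) \<in> fibre k g i"
    using f1 by (auto simp: fibre_def compose_def)
  then obtain l where l: "l \<in> {1..fibre_size k g i}" "f (offset m ?gf i + j) = offset k g i + l"
    using bij_betw_imp_surj_on[OF fibre_shift[OF gm, of i]] by blast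
  have "induced m k f g i j = l"
    using j l by (simp add: induced_def Let_def)
  with l show "induced m k f g i j \<in> {1..fibre_size k g i}"
    and "offset k g i + induced m k f g i j = f (offset m ?gf i + j)" by auto
qed


section \<open>Constant-free non-symmetric categorical operads\<close>

text \<open>
  The structure functor of \<open>g\<close> from \<open>k\<close> to \<open>n\<close> is given by \<open>muO P k n g\<close> on objects and
  \<open>muA P k n g\<close> on morphisms; the value of \<open>OpCat P\<close> at \<open>0\<close> is irrelevant.
\<close>

record ('o, 'a) operad =
  OpCat :: "nat \<Rightarrow> ('o, 'a) cat"
  muO :: "nat \<Rightarrow> nat \<Rightarrow> (nat \<Rightarrow> nat) \<Rightarrow> 'o \<times> (nat \<Rightarrow> 'o) \<Rightarrow> 'o"
  muA :: "nat \<Rightarrow> nat \<Rightarrow> (nat \<Rightarrow> nat) \<Rightarrow> 'a \<times> (nat \<Rightarrow> 'a) \<Rightarrow> 'a"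
  OpUnit :: 'o

definition mu_source ::
    "('o, 'a) operad \<Rightarrow> nat \<Rightarrow> nat \<Rightarrow> (nat \<Rightarrow> nat) \<Rightarrow> ('o \<times> (nat \<Rightarrow> 'o), 'a \<times> (nat \<Rightarrow> 'a)) cat" where
  "mu_source P k n g =
     prod_cat (OpCat P n) (family_cat {1..n} (\<lambda>i. OpCat P (fibre_size k g i)))"

locale ns_cat_operad =
  fixes P :: "('o, 'a) operad"
  assumes category: "n \<ge> 1 \<Longrightarrow> category (OpCat P n)"
    and mu_functor: "n \<ge> 1 \<Longrightarrow> k \<ge> 1 \<Longrightarrow> g \<in> surjections k n \<Longrightarrow>
      cat_functor (mu_source P k n g) (OpCat P k) (muO P k n g) (muA P k n g)"
    and unit_Ob: "OpUnit P \<in> Ob (OpCat P 1)"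
    and assoc_Ob: "n \<ge> 1 \<Longrightarrow> k \<ge> 1 \<Longrightarrow> m \<ge> 1 \<Longrightarrow> f \<in> surjections m k \<Longrightarrow> g \<in> surjections k n \<Longrightarrow>
      (c, b) \<in> Ob (mu_source P k n g) \<Longrightarrow>
      a \<in> (\<Pi>\<^sub>E j\<in>{1..k}. Ob (OpCat P (fibre_size m f j))) \<Longrightarrow>
      muO P m k f (muO P k n g (c, b), a) =
      muO P m n (compose {1..m} g f)
        (c, \<lambda>i\<in>{1..n}. muO P (fibre_size m (compose {1..m} g f) i) (fibre_size k g i)
               (induced m k f g i) (b i, block k g a i))"
    and assoc_Arr: "n \<ge> 1 \<Longrightarrow> k \<ge> 1 \<Longrightarrow> m \<ge> 1 \<Longrightarrow> f \<in> surjections m k \<Longrightarrow> g \<in> surjections k n \<Longrightarrow>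
      (\<gamma>, \<beta>) \<in> Arr (mu_source P k n g) \<Longrightarrow>
      \<alpha> \<in> (\<Pi>\<^sub>E j\<in>{1..k}. Arr (OpCat P (fibre_size m f j))) \<Longrightarrow>
      muA P m k f (muA P k n g (\<gamma>, \<beta>), \<alpha>) =
      muA P m n (compose {1..m} g f)
        (\<gamma>, \<lambda>i\<in>{1..n}. muA P (fibre_size m (compose {1..m} g f) i) (fibre_size k g i)
               (induced m k f g i) (\<beta> i, block k g \<alpha> i))"
    and right_unit_Ob: "n \<ge> 1 \<Longrightarrow> c \<in> Ob (OpCat P n) \<Longrightarrow>
      muO P n n (ord_id n) (c, \<lambda>i\<in>{1..n}. OpUnit P) = c"
    and right_unit_Arr: "n \<ge> 1 \<Longrightarrow> \<gamma> \<in> Arr (OpCat P n) \<Longrightarrow>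
      muA P n n (ord_id n) (\<gamma>, \<lambda>i\<in>{1..n}. Id (OpCat P 1) (OpUnit P)) = \<gamma>"
    and left_unit_Ob: "n \<ge> 1 \<Longrightarrow> c \<in> Ob (OpCat P n) \<Longrightarrow>
      muO P n 1 (ord_bang n) (OpUnit P, \<lambda>i\<in>{1..1}. c) = c"
    and left_unit_Arr: "n \<ge> 1 \<Longrightarrow> \<gamma> \<in> Arr (OpCat P n) \<Longrightarrow>
      muA P n 1 (ord_bang n) (Id (OpCat P 1) (OpUnit P), \<lambda>i\<in>{1..1}. \<gamma>) = \<gamma>"


section \<open>The underlying category of the integration of an operad\<close>

text \<open>
  \<open>OneCell (m, x) (k, b) f a \<alpha>\<close> is \<open>[f; a\<^sub>1, \<dots>, a\<^sub>k; \<alpha>]\<close> from \<open>[m, x]\<close> to \<open>[k, b]\<close>. The end points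
  are recorded since \<open>f\<close>, \<open>a\<close> and \<open>\<alpha>\<close> do not determine \<open>b\<close>.
\<close>

datatype ('o, 'a) onecell =
  OneCell (src: "nat \<times> 'o") (tgt: "nat \<times> 'o") (ordmap: "nat \<Rightarrow> nat") (objs: "nat \<Rightarrow> 'o") (mor: 'a)

definition int_Ob :: "('o, 'a) operad \<Rightarrow> (nat \<times> 'o) set" where
  "int_Ob P = {(m, x). m \<ge> 1 \<and> x \<in> Ob (OpCat P m)}"

definition int_Arr :: "('o, 'a) operad \<Rightarrow> ('o, 'a) onecell set" where
  "int_Arr P = {OneCell (m, x) (k, b) f a \<alpha> | m x k b f a \<alpha>.
     (m, x) \<in> int_Ob P \<and> (k, b) \<in> int_Ob P \<and> f \<in> surjections m k \<and>
     a \<in> (\<Pi>\<^sub>E i\<in>{1..k}. Ob (OpCat P (fibre_size m f i))) \<and>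
     \<alpha> \<in> Hom (OpCat P m) (muO P m k f (b, a)) x}"

fun int_Id :: "('o, 'a) operad \<Rightarrow> nat \<times> 'o \<Rightarrow> ('o, 'a) onecell" where
  "int_Id P (m, x) =
     OneCell (m, x) (m, x) (ord_id m) (\<lambda>i\<in>{1..m}. OpUnit P) (Id (OpCat P m) x)"

text \<open>
  In the last component of the composite, the objects \<open>a\<^sub>i\<close> in \<open>\<mu>\<^sub>f(\<beta>, a\<^sub>1, \<dots>, a\<^sub>k)\<close> stand for their
  identity morphisms. The target of the first one-cell is only used when it equals \<open>(k, b)\<close>.
\<close>

fun int_Comp :: "('o, 'a) operad \<Rightarrow> ('o, 'a) onecell \<Rightarrow> ('o, 'a) onecell \<Rightarrow> ('o, 'a) onecell" where
  "int_Comp P (OneCell (k, y) (n, z) g b \<beta>) (OneCell (m, x) _ f a \<alpha>) =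
     (let gf = compose {1..m} g f in
      OneCell (m, x) (n, z) gf
        (\<lambda>i\<in>{1..n}. muO P (fibre_size m gf i) (fibre_size k g i) (induced m k f g i)
             (b i, block k g a i))
        (Comp (OpCat P m) \<alpha>
           (muA P m k f (\<beta>, \<lambda>j\<in>{1..k}. Id (OpCat P (fibre_size m f j)) (a j)))))"

definition int_cat :: "('o, 'a) operad \<Rightarrow> (nat \<times> 'o, ('o, 'a) onecell) cat" where
  "int_cat P = \<lparr> Ob = int_Ob P, Arr = int_Arr P, Dom = src, Cod = tgt,
     Id = int_Id P, Comp = int_Comp P \<rparr>"

definition int_E :: "('o, 'a) operad \<Rightarrow> ('o, 'a) onecell set" where
  "int_E P = {OneCell (m, x) (k, b) f a \<alpha> | m x k b f a \<alpha>.
     OneCell (m, x) (k, b) f a \<alpha> \<in> Arr (int_cat P) \<and>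
     k = m \<and> f = ord_id m \<and> (\<forall>i \<in> {1..k}. a i = OpUnit P)}"

definition int_M :: "('o, 'a) operad \<Rightarrow> ('o, 'a) onecell set" where
  "int_M P = {OneCell (m, x) (k, b) f a \<alpha> | m x k b f a \<alpha>.
     OneCell (m, x) (k, b) f a \<alpha> \<in> Arr (int_cat P) \<and>
     (\<exists>y \<in> Ob (OpCat P m). \<alpha> = Id (OpCat P m) y)}"

end

theory Submission
  imports Defs
begin

text \<open>
  Composing \<open>[f; a; \<beta>]\<close> with a one-cell \<open>[1; e, \<dots>, e; \<alpha>]\<close> on the right only replaces \<open>\<beta>\<close> by
  \<open>\<alpha> \<circ> \<beta>\<close>, by the right unit laws. With \<open>\<beta> = 1\<close> this gives the factorization; it is unique because
  the middle object of a factorization through \<open>M\<close> is forced to be \<open>\<mu>\<^sub>f(b, a)\<close>. The real work is that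
  one-cells compose associatively: there the operad associativity is applied blockwise, which needs
  that cutting \<open>k\<close> into the fibres of \<open>h \<circ> g\<close> and then each fibre along the map induced by \<open>g\<close> is
  the same as cutting \<open>k\<close> along \<open>g\<close>.
\<close>

text \<open>Keeps \<open>1\<close> in the form in which it occurs in \<open>{1..n}\<close>,
  \<open>OpCat P 1\<close> and the unit laws.\<close>

declare One_nat_def [simp del]

section \<open>Fibres of composites\<close>

lemma surjections_range: "f \<in> surjections m k \<Longrightarrow> x \<in> {1..m} \<Longrightarrow> f x \<in> {1..k}"
  by (auto simp: surjections_def)

lemma surjections_mono: "f \<in> surjections m k \<Longrightarrow> mono_on {1..m} f"
  by (simp add: surjections_def)

lemma surjections_le:
  "f \<in> surjections m k \<Longrightarrow> x \<in> {1..m} \<Longrightarrow> y \<in> {1..m} \<Longrightarrow> x \<le> y \<Longrightarrow> f x \<le> f y"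
  using mono_onD[OF surjections_mono] by blast

lemma surjections_extensional: "f \<in> surjections m k \<Longrightarrow> f \<in> extensional {1..m}"
  by (auto simp: surjections_def PiE_def)

text \<open>The operad axioms ask for every ordinal involved to be nonempty; a surjection transports
  this, so one positivity hypothesis suffices later.\<close>

lemma surjections_pos_iff:
  assumes "f \<in> surjections m k"
  shows "m \<ge> 1 \<longleftrightarrow> k \<ge> 1"
proof -
  have "f ` {1..m} = {1..k}"
    using assms by (simp add: surjections_def)
  then have "{1..m} = {} \<longleftrightarrow> {1..k} = {}"
    by (metis image_is_empty)
  then show ?thesis by simp
qed

lemma surjections_compose:
  assumes "f \<in> surjections m k" "g \<in> surjections k n"
  shows "compose {1..m} g f \<in> surjections m n"
proof -
  have "compose {1..m} g f ` {1..m} = g ` f ` {1..m}"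
    by (auto simp: compose_def)
  moreover have "mono_on {1..m} (compose {1..m} g f)"
  proof (rule mono_onI)
    fix r s assume "r \<in> {1..m}" "s \<in> {1..m}" "r \<le> s"
    then show "compose {1..m} g f r \<le> compose {1..m} g f s"
      using surjections_le[OF assms(2)] surjections_le[OF assms(1)] surjections_range[OF assms(1)]
      by (simp add: compose_def del: atLeastAtMost_iff)
  qed
  ultimately show ?thesis
    using assms surjections_range[OF assms(1)] surjections_range[OF assms(2)]
    by (auto simp: surjections_def compose_def simp del: atLeastAtMost_iff)
qed

lemma surjections_compose_assoc:
  assumes "f \<in> surjections m k"
  shows "compose {1..m} (compose {1..k} h g) f = compose {1..m} h (compose {1..m} g f)"
  using surjections_range[OF assms] by (auto simp: compose_def fun_eq_iff simp del: atLeastAtMost_iff)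

section \<open>Translation coordinates on fibres and the maps induced between them\<close>

lemma offset_fibre:
  assumes "g \<in> surjections k n" "j \<in> {1..fibre_size k g i}"
  shows "offset k g i + j \<in> {1..k}" "g (offset k g i + j) = i"
  using bij_betwE[OF fibre_shift[OF surjections_mono[OF assms(1)], of i]] assms(2)
  by (auto simp: fibre_def)

lemma fibre_size_pos:
  assumes "g \<in> surjections k n" "i \<in> {1..n}"
  shows "fibre_size k g i \<ge> 1"
proof -
  have "i \<in> g ` {1..k}"
    using assms by (simp add: surjections_def)
  then have "fibre k g i \<noteq> {}" by (auto simp: fibre_def)
  moreover have "finite (fibre k g i)" by (simp add: fibre_def)
  ultimately show ?thesis
    by (simp add: fibre_size_def One_nat_def Suc_le_eq card_gt_0_iff)
qed

lemma offset_fibre_exhaust: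
  assumes "g \<in> surjections k n" "l \<in> {1..k}"
  obtains j where "j \<in> {1..fibre_size k g (g l)}" "l = offset k g (g l) + j"
proof -
  have "l \<in> fibre k g (g l)" using assms by (simp add: fibre_def)
  then show ?thesis
    using that bij_betw_imp_surj_on[OF fibre_shift[OF surjections_mono[OF assms(1)], of "g l"]]
    by blast
qed

text \<open>Translation by the offset is injective, so counting in local coordinates is counting in
  the fibre. Both the sizes and the offsets of fibres of an induced map are computed this
  way.\<close>

lemma card_fibre_shift:
  assumes "g \<in> surjections k n"
  shows "card {l \<in> {1..fibre_size k g i}. Q (offset k g i + l)} = card {l \<in> fibre k g i. Q l}"
proof -
  have "fibre k g i = (\<lambda>j. offset k g i + j) ` {1..fibre_size k g i}"
    using bij_betw_imp_surj_on[OF fibre_shift[OF surjections_mono[OF assms]]] by metis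
  then have "{l \<in> fibre k g i. Q l} =
      (\<lambda>j. offset k g i + j) ` {l \<in> {1..fibre_size k g i}. Q (offset k g i + l)}"
    by (simp only:) blast
  then show ?thesis by (simp add: card_image)
qed

text \<open>Up to translation the induced map is a restriction of \<open>f\<close>, hence monotone.
  It is onto because an \<open>f\<close>-preimage of a point over \<open>i\<close> lies in the fibre
  of the composite over \<open>i\<close>.\<close>

lemma induced_surjections:
  assumes f: "f \<in> surjections m k" and g: "g \<in> surjections k n"
  shows "induced m k f g i \<in> surjections (fibre_size m (compose {1..m} g f) i) (fibre_size k g i)"
proof -
  let ?gf = "compose {1..m} g f"
  let ?mi = "fibre_size m ?gf i" and ?ki = "fibre_size k g i"
  note gf = surjections_compose[OF f g]
  note sh = induced_shift[OF f g]
  have "induced m k f g i \<in> {1..?mi} \<rightarrow>\<^sub>E {1..?ki}"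
    using sh(1) by (auto simp: induced_def Let_def)
  moreover have "mono_on {1..?mi} (induced m k f g i)"
  proof (rule mono_onI)
    fix r s assume rs: "r \<in> {1..?mi}" "s \<in> {1..?mi}" "r \<le> s"
    have "f (offset m ?gf i + r) \<le> f (offset m ?gf i + s)"
      using rs(3) offset_fibre(1)[OF gf rs(1)] offset_fibre(1)[OF gf rs(2)]
      by (intro surjections_le[OF f]) auto
    then show "induced m k f g i r \<le> induced m k f g i s"
      using sh(2)[OF rs(1)] sh(2)[OF rs(2)] by linarith
  qed
  moreover have "{1..?ki} \<subseteq> induced m k f g i ` {1..?mi}"
  proof
    fix j assume j: "j \<in> {1..?ki}"
    have "offset k g i + j \<in> f ` {1..m}"
      using offset_fibre(1)[OF g j] f by (simp add: surjections_def)
    then obtain x where x: "x \<in> {1..m}" "f x = offset k g i + j" by auto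
    then have "?gf x = i"
      using offset_fibre(2)[OF g j] by (simp add: compose_def)
    then obtain l where l: "l \<in> {1..?mi}" "x = offset m ?gf i + l"
      using offset_fibre_exhaust[OF gf x(1)] by metis
    then have "induced m k f g i l = j"
      using sh(2)[OF l(1)] x(2) by simp
    then show "j \<in> induced m k f g i ` {1..?mi}" using l(1) by blast
  qed
  ultimately show ?thesis
    by (auto simp: surjections_def simp del: atLeastAtMost_iff)
qed

text \<open>All \<open>f\<close>-preimages of a point over \<open>i\<close> lie over
  \<open>i\<close> themselves, so restricting \<open>f\<close> to the fibre of the composite loses
  none of them.\<close>

lemma fibre_size_induced:
  assumes f: "f \<in> surjections m k" and g: "g \<in> surjections k n" and j: "j \<in> {1..fibre_size k g i}"
  shows "fibre_size (fibre_size m (compose {1..m} g f) i) (induced m k f g i) j =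
    fibre_size m f (offset k g i + j)"
proof -
  let ?gf = "compose {1..m} g f"
  let ?mi = "fibre_size m ?gf i"
  have "{l \<in> {1..?mi}. induced m k f g i l = j} =
      {l \<in> {1..?mi}. f (offset m ?gf i + l) = offset k g i + j}"
    using induced_shift(2)[OF f g, of _ i, symmetric] by auto
  then have "fibre_size ?mi (induced m k f g i) j =
      card {l \<in> fibre m ?gf i. f l = offset k g i + j}"
    using card_fibre_shift[OF surjections_compose[OF f g], of i "\<lambda>l. f l = offset k g i + j"]
    by (simp add: fibre_size_def fibre_def)
  also have "{l \<in> fibre m ?gf i. f l = offset k g i + j} = fibre m f (offset k g i + j)"
    using offset_fibre(2)[OF g j] by (auto simp: fibre_def compose_def)
  finally show ?thesis by (simp add: fibre_size_def)
qed

text \<open>Let \<open>?c\<close> be the point with local coordinate \<open>j\<close> over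
  \<open>i\<close>. The points that \<open>f\<close> sends below \<open>?c\<close> split into those
  lying over some \<open>i' < i\<close> and those over \<open>i\<close> itself; counting the two
  parts gives the two offsets.\<close>

lemma offset_induced:
  assumes f: "f \<in> surjections m k" and g: "g \<in> surjections k n" and j: "j \<in> {1..fibre_size k g i}"
  shows "offset m (compose {1..m} g f) i +
      offset (fibre_size m (compose {1..m} g f) i) (induced m k f g i) j =
    offset m f (offset k g i + j)"
proof -
  let ?gf = "compose {1..m} g f"
  let ?mi = "fibre_size m ?gf i" and ?c = "offset k g i + j"
  note c = offset_fibre[OF g j]
  have "{l \<in> {1..?mi}. induced m k f g i l < j} = {l \<in> {1..?mi}. f (offset m ?gf i + l) < ?c}"
    using induced_shift(2)[OF f g, of _ i, symmetric] by auto
  then have "offset ?mi (induced m k f g i) j = card {l \<in> fibre m ?gf i. f l < ?c}"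
    using card_fibre_shift[OF surjections_compose[OF f g], of i "\<lambda>l. f l < ?c"]
    by (simp add: offset_def)
  moreover have "{l \<in> {1..m}. f l < ?c} =
      {l \<in> {1..m}. ?gf l < i} \<union> {l \<in> fibre m ?gf i. f l < ?c}"
  proof -
    \<comment> \<open>Since \<open>g\<close> maps \<open>?c\<close> to \<open>i\<close>,
      monotonicity of \<open>g\<close> gives both inclusions of the splitting.\<close>
    have "g (f l) \<le> i" if "l \<in> {1..m}" "f l < ?c" for l
      using surjections_le[OF g surjections_range[OF f that(1)] c(1)] that c(2) by simp
    moreover have "f l < ?c" if "l \<in> {1..m}" "g (f l) < i" for l
      using surjections_le[OF g c(1) surjections_range[OF f that(1)]] that c(2) by force
    ultimately show ?thesis
      by (force simp: fibre_def compose_def simp del: atLeastAtMost_iff)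
  qed
  moreover have "{l \<in> {1..m}. ?gf l < i} \<inter> {l \<in> fibre m ?gf i. f l < ?c} = {}"
    by (auto simp: fibre_def)
  ultimately show ?thesis
    by (simp add: offset_def card_Un_disjoint fibre_def)
qed

text \<open>After adding \<open>offset n h i\<close> both sides become the value of \<open>g\<close>
  after \<open>f\<close> at the same point. This is the rule
  \<open>(gf)\<^sup>i = g\<^sup>i f\<^sup>i\<close> for passing to fibres.\<close>

lemma induced_compose:
  assumes f: "f \<in> surjections m k" and g: "g \<in> surjections k n" and h: "h \<in> surjections n p"
  defines "hg \<equiv> compose {1..k} h g"
  shows "compose {1..fibre_size m (compose {1..m} hg f) i} (induced k n g h i) (induced m k f hg i) =
    induced m n (compose {1..m} g f) h i"
proof -
  let ?gf = "compose {1..m} g f" and ?hgf = "compose {1..m} hg f"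
  have hg: "hg \<in> surjections k p" unfolding hg_def using surjections_compose[OF g h] .
  have eq: "compose {1..m} h ?gf = ?hgf"
    unfolding hg_def by (simp add: surjections_compose_assoc[OF f])
  note gf = surjections_compose[OF f g] and hgf = surjections_compose[OF f hg]
  let ?mi = "fibre_size m ?hgf i"
  show ?thesis
  proof (rule extensionalityI)
    show "compose {1..?mi} (induced k n g h i) (induced m k f hg i) \<in> extensional {1..?mi}"
      by simp
    show "induced m n ?gf h i \<in> extensional {1..?mi}"
      using surjections_extensional[OF induced_surjections[OF gf h, of i]] by (simp add: eq)
    fix j assume j: "j \<in> {1..?mi}"
    note a = induced_shift[OF f hg j]
    have "offset n h i + induced k n g h i (induced m k f hg i j) =
        g (f (offset m ?hgf i + j))"
      using induced_shift(2)[OF g h, of "induced m k f hg i j" i] a by (simp add: hg_def)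
    also have "\<dots> = offset n h i + induced m n ?gf h i j"
      using induced_shift(2)[OF gf h, of j i] j offset_fibre(1)[OF hgf j]
      by (simp add: eq compose_eq del: atLeastAtMost_iff)
    finally show "compose {1..?mi} (induced k n g h i) (induced m k f hg i) j =
        induced m n ?gf h i j"
      using j by (simp add: compose_eq)
  qed
qed

text \<open>Restricting \<open>f\<close> first over \<open>i\<close> and then over the local point
  \<open>j\<close> is restricting it once over the global point \<open>offset n h i + j\<close>: the
  nested fibres have the same sizes and total offsets as the direct ones.\<close>

lemma induced_induced:
  assumes f: "f \<in> surjections m k" and g: "g \<in> surjections k n" and h: "h \<in> surjections n p"
    and j: "j \<in> {1..fibre_size n h i}"
  defines "hg \<equiv> compose {1..k} h g"
  shows "induced (fibre_size m (compose {1..m} hg f) i) (fibre_size k hg i)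
      (induced m k f hg i) (induced k n g h i) j =
    induced m k f g (offset n h i + j)"
proof -
  let ?gf = "compose {1..m} g f" and ?hgf = "compose {1..m} hg f"
  have hg: "hg \<in> surjections k p" unfolding hg_def using surjections_compose[OF g h] .
  have eq: "compose {1..m} h ?gf = ?hgf"
    unfolding hg_def by (simp add: surjections_compose_assoc[OF f])
  note gf = surjections_compose[OF f g] and hgf = surjections_compose[OF f hg]
  let ?mi = "fibre_size m ?hgf i" and ?ki = "fibre_size k hg i" and ?c = "offset n h i + j"
  let ?fi = "induced m k f hg i" and ?gi = "induced k n g h i"
  have fi: "?fi \<in> surjections ?mi ?ki" using induced_surjections[OF f hg] .
  have gi: "?gi \<in> surjections ?ki (fibre_size n h i)"
    using induced_surjections[OF g h] by (simp add: hg_def)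
  have comp: "compose {1..?mi} ?gi ?fi = induced m n ?gf h i"
    using induced_compose[OF f g h] by (simp add: hg_def)
  have size: "fibre_size ?mi (compose {1..?mi} ?gi ?fi) j = fibre_size m ?gf ?c"
    using fibre_size_induced[OF gf h j] by (simp add: comp eq)
  have off_m: "offset m ?hgf i + offset ?mi (compose {1..?mi} ?gi ?fi) j = offset m ?gf ?c"
    using offset_induced[OF gf h j] by (simp add: comp eq)
  have off_k: "offset k hg i + offset ?ki ?gi j = offset k g ?c"
    using offset_induced[OF g h j] by (simp add: hg_def)
  show ?thesis
  proof (rule extensionalityI)
    show "induced ?mi ?ki ?fi ?gi j \<in> extensional {1..fibre_size m ?gf ?c}"
      using surjections_extensional[OF induced_surjections[OF fi gi, of j]] by (simp add: size)
    show "induced m k f g ?c \<in> extensional {1..fibre_size m ?gf ?c}"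
      using surjections_extensional[OF induced_surjections[OF f g]] .
    fix l assume l: "l \<in> {1..fibre_size m ?gf ?c}"
    then have l': "l \<in> {1..fibre_size ?mi (compose {1..?mi} ?gi ?fi) j}" by (simp add: size)
    let ?l = "offset ?mi (compose {1..?mi} ?gi ?fi) j + l"
    have "?l \<in> {1..?mi}"
      using offset_fibre(1)[OF surjections_compose[OF fi gi] l'] .
    then have "offset k hg i + ?fi ?l = f (offset m ?hgf i + ?l)"
      using induced_shift(2)[OF f hg] by blast
    \<comment> \<open>The two nested offsets add up to a single one, so \<open>f\<close> is
      evaluated at the point that the direct restriction uses.\<close>
    also have "offset m ?hgf i + ?l = offset m ?gf ?c + l"
      using off_m by simp
    also have "f \<dots> = offset k g ?c + induced m k f g ?c l"
      using induced_shift(2)[OF f g l] by simp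
    finally have "offset k hg i + ?fi ?l = offset k g ?c + induced m k f g ?c l" .
    then show "induced ?mi ?ki ?fi ?gi j l = induced m k f g ?c l"
      using induced_shift(2)[OF fi gi l'] off_k by linarith
  qed
qed

text \<open>Cutting a sequence in two stages reads the same entries as cutting it once, because
  lengths and total offsets agree.\<close>

lemma block_block:
  assumes g: "g \<in> surjections k n" and h: "h \<in> surjections n p" and j: "j \<in> {1..fibre_size n h i}"
  shows "block (fibre_size k (compose {1..k} h g) i) (induced k n g h i)
      (block k (compose {1..k} h g) a i) j =
    block k g a (offset n h i + j)"
proof -
  let ?hg = "compose {1..k} h g"
  note size = fibre_size_induced[OF g h j]
  have "offset (fibre_size k ?hg i) (induced k n g h i) j + l \<in> {1..fibre_size k ?hg i}"
    if "l \<in> {1..fibre_size k g (offset n h i + j)}" for l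
    using offset_fibre(1)[OF induced_surjections[OF g h], of l i j] that size by simp
  then show ?thesis
    using offset_induced[OF g h j, symmetric]
    by (auto simp: block_def size add.assoc simp del: atLeastAtMost_iff)
qed

text \<open>Entry \<open>j\<close> of the block belongs to the point
  \<open>offset k g i + j\<close>, whose \<open>f\<close>-fibre has the size of the fibre of the
  induced map over \<open>j\<close>. Hence blocks are admissible arguments for the operad structure
  of induced maps.\<close>

lemma block_PiE:
  assumes f: "f \<in> surjections m k" and g: "g \<in> surjections k n"
    and a: "a \<in> (\<Pi>\<^sub>E j\<in>{1..k}. X (fibre_size m f j))"
  shows "block k g a i \<in>
    (\<Pi>\<^sub>E j\<in>{1..fibre_size k g i}.
       X (fibre_size (fibre_size m (compose {1..m} g f) i) (induced m k f g i) j))"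
proof (rule PiE_I)
  fix j assume j: "j \<in> {1..fibre_size k g i}"
  show "block k g a i j \<in>
      X (fibre_size (fibre_size m (compose {1..m} g f) i) (induced m k f g i) j)"
    using j PiE_mem[OF a offset_fibre(1)[OF g j]] fibre_size_induced[OF f g j]
    by (simp add: block_def)
qed (auto simp: block_def)

section \<open>Identity maps: their fibres, blocks and induced maps\<close>

lemma ord_id_surjections: "ord_id n \<in> surjections n n"
proof -
  have "mono_on {1..n} (ord_id n)" by (rule mono_onI) (simp add: ord_id_def)
  moreover have "ord_id n ` {1..n} = {1..n}" by (simp add: ord_id_def)
  moreover have "ord_id n \<in> {1..n} \<rightarrow>\<^sub>E {1..n}" by (auto simp: ord_id_def)
  ultimately show ?thesis by (simp add: surjections_def)
qed

lemma compose_ord_id_left: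
  assumes f: "f \<in> surjections m k"
  shows "compose {1..m} (ord_id k) f = f"
proof (rule extensionalityI)
  show "f \<in> extensional {1..m}" using surjections_extensional[OF f] .
  show "compose {1..m} (ord_id k) f x = f x" if "x \<in> {1..m}" for x
    using that surjections_range[OF f that] by (simp only: compose_eq ord_id_def restrict_apply')
qed simp

lemma compose_ord_id_right:
  assumes f: "f \<in> surjections m k"
  shows "compose {1..m} f (ord_id m) = f"
proof (rule extensionalityI)
  show "f \<in> extensional {1..m}" using surjections_extensional[OF f] .
  show "compose {1..m} f (ord_id m) x = f x" if "x \<in> {1..m}" for x
    using that by (simp only: compose_eq ord_id_def restrict_apply')
qed simp

lemma fibre_size_ord_id: "i \<in> {1..n} \<Longrightarrow> fibre_size n (ord_id n) i = 1"
proof -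
  assume "i \<in> {1..n}"
  then have "fibre n (ord_id n) i = {i}" by (auto simp: fibre_def ord_id_def)
  then show ?thesis by (simp add: fibre_size_def)
qed

lemma offset_ord_id: "i \<in> {1..n} \<Longrightarrow> offset n (ord_id n) i = i - 1"
proof -
  assume "i \<in> {1..n}"
  then have "{j \<in> {1..n}. ord_id n j < i} = {1..i - 1}" by (auto simp: ord_id_def)
  then show ?thesis by (simp add: offset_def)
qed

lemma block_ord_id:
  assumes "i \<in> {1..n}"
  shows "block n (ord_id n) a i = (\<lambda>j\<in>{1..1}. a i)"
  unfolding block_def fibre_size_ord_id[OF assms] offset_ord_id[OF assms]
proof (rule restrict_ext)
  fix j :: nat assume "j \<in> {1..1}"
  then have "i - 1 + j = i" using assms by auto
  then show "a (i - 1 + j) = a i" by simp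
qed

text \<open>The fibre of the identity over \<open>i\<close> is a single point with offset
  \<open>i - 1\<close>, so the induced map is constant with value \<open>i - (i - 1) = 1\<close>.
  This is the shape of the left unit law.\<close>

lemma induced_ord_id_left:
  assumes f: "f \<in> surjections m k" and i: "i \<in> {1..k}"
  shows "induced m k f (ord_id k) i = ord_bang (fibre_size m f i)"
  unfolding induced_def Let_def compose_ord_id_left[OF f] offset_ord_id[OF i] ord_bang_def
proof (rule restrict_ext)
  fix j assume "j \<in> {1..fibre_size m f i}"
  then show "f (offset m f i + j) - (i - 1) = 1"
    using offset_fibre(2)[OF f] i by simp
qed

text \<open>The same offset is added and then subtracted. This is the shape of the right unit law on
  each fibre.\<close>

lemma induced_ord_id_right:
  assumes f: "f \<in> surjections m k"
  shows "induced m m (ord_id m) f i = ord_id (fibre_size m f i)"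
  unfolding induced_def Let_def compose_ord_id_right[OF f] ord_id_def[of "fibre_size m f i"]
proof (rule restrict_ext)
  fix j assume "j \<in> {1..fibre_size m f i}"
  then show "ord_id m (offset m f i + j) - offset m f i = j"
    using offset_fibre(1)[OF f] by (simp add: ord_id_def)
qed

lemma block_const:
  assumes "f \<in> surjections m k"
  shows "block m f (\<lambda>j\<in>{1..m}. x) i = (\<lambda>j\<in>{1..fibre_size m f i}. x)"
  unfolding block_def
proof (rule restrict_ext)
  fix j assume "j \<in> {1..fibre_size m f i}"
  then show "(\<lambda>j\<in>{1..m}. x) (offset m f i + j) = x"
    using offset_fibre(1)[OF assms] by (simp only: restrict_apply')
qed

section \<open>Whiskering in a categorical operad\<close>

abbreviation obj_families :: "('o, 'a) operad \<Rightarrow> nat \<Rightarrow> nat \<Rightarrow> (nat \<Rightarrow> nat) \<Rightarrow> (nat \<Rightarrow> 'o) set" where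
  "obj_families P m k f \<equiv> \<Pi>\<^sub>E j\<in>{1..k}. Ob (OpCat P (fibre_size m f j))"

text \<open>The identity of \<open>a\<close> in the \<open>family_cat\<close> factor of
  \<open>mu_source P m k f\<close>; it makes precise how objects are inserted into \<mu> next to a
  morphism.\<close>

definition id_family ::
    "('o, 'a) operad \<Rightarrow> nat \<Rightarrow> nat \<Rightarrow> (nat \<Rightarrow> nat) \<Rightarrow> (nat \<Rightarrow> 'o) \<Rightarrow> nat \<Rightarrow> 'a" where
  "id_family P m k f a = (\<lambda>j\<in>{1..k}. Id (OpCat P (fibre_size m f j)) (a j))"

text \<open>\<open>block_mu\<close> is the family \<open>\<mu>\<^bsub>f\<^sup>i\<^esub>(b\<^sub>i, a\<^sup>i\<^sub>1, \<dots>)\<close> of objects of a composite one-cell.\<close>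

definition block_mu ::
    "('o, 'a) operad \<Rightarrow> nat \<Rightarrow> nat \<Rightarrow> nat \<Rightarrow> (nat \<Rightarrow> nat) \<Rightarrow> (nat \<Rightarrow> nat) \<Rightarrow>
      (nat \<Rightarrow> 'o) \<Rightarrow> (nat \<Rightarrow> 'o) \<Rightarrow> nat \<Rightarrow> 'o" where
  "block_mu P m k n f g b a =
     (\<lambda>i\<in>{1..n}. muO P (fibre_size m (compose {1..m} g f) i) (fibre_size k g i)
        (induced m k f g i) (b i, block k g a i))"

lemma Ob_mu_source:
  "(c, b) \<in> Ob (mu_source P k n g) \<longleftrightarrow> c \<in> Ob (OpCat P n) \<and> b \<in> obj_families P k n g"
  by (simp add: mu_source_def prod_cat_def family_cat_def)

lemma Arr_mu_source:
  "(\<gamma>, \<beta>) \<in> Arr (mu_source P k n g) \<longleftrightarrow>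
    \<gamma> \<in> Arr (OpCat P n) \<and> \<beta> \<in> (\<Pi>\<^sub>E j\<in>{1..n}. Arr (OpCat P (fibre_size k g j)))"
  by (simp add: mu_source_def prod_cat_def family_cat_def)

lemma Id_mu_source: "Id (mu_source P k n g) (c, b) = (Id (OpCat P n) c, id_family P k n g b)"
  by (simp add: mu_source_def prod_cat_def family_cat_def id_family_def)

lemma HomD: "f \<in> Hom C x y \<Longrightarrow> f \<in> Arr C \<and> Dom C f = x \<and> Cod C f = y"
  by (simp add: Hom_def)

context ns_cat_operad
begin

lemma fibre_category:
  "f \<in> surjections m k \<Longrightarrow> j \<in> {1..k} \<Longrightarrow> Defs.category (OpCat P (fibre_size m f j))"
  using category[OF fibre_size_pos] .

lemma mu_functor': "g \<in> surjections k n \<Longrightarrow> k \<ge> 1 \<Longrightarrow>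
    cat_functor (mu_source P k n g) (OpCat P k) (muO P k n g) (muA P k n g)"
  using mu_functor surjections_pos_iff by blast

lemma muO_Ob:
  assumes "g \<in> surjections k n" "k \<ge> 1" "c \<in> Ob (OpCat P n)" "b \<in> obj_families P k n g"
  shows "muO P k n g (c, b) \<in> Ob (OpCat P k)"
proof -
  interpret cat_functor "mu_source P k n g" "OpCat P k" "muO P k n g" "muA P k n g"
    using mu_functor'[OF assms(1,2)] .
  show ?thesis using FO_Ob assms(3,4) by (simp add: Ob_mu_source)
qed

lemma id_family_Hom:
  assumes "g \<in> surjections k n" "b \<in> obj_families P k n g" "j \<in> {1..n}"
  shows "id_family P k n g b j \<in> Hom (OpCat P (fibre_size k g j)) (b j) (b j)"
  using category.Id_Hom[OF fibre_category[OF assms(1,3)] PiE_mem[OF assms(2,3)]] assms(3)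
  by (simp add: id_family_def)

lemma id_family_Arr:
  assumes "g \<in> surjections k n" "b \<in> obj_families P k n g"
  shows "id_family P k n g b \<in> (\<Pi>\<^sub>E j\<in>{1..n}. Arr (OpCat P (fibre_size k g j)))"
proof (rule PiE_I)
  show "id_family P k n g b j \<in> Arr (OpCat P (fibre_size k g j))" if "j \<in> {1..n}" for j
    using HomD[OF id_family_Hom[OF assms that]] by blast
qed (auto simp: id_family_def)

lemma whisker_source_Hom:
  assumes "g \<in> surjections k n" "\<gamma> \<in> Hom (OpCat P n) c c'" "b \<in> obj_families P k n g"
  shows "(\<gamma>, id_family P k n g b) \<in> Hom (mu_source P k n g) (c, b) (c', b)"
proof -
  \<comment> \<open>Domains and codomains in \<open>family_cat\<close> are restricted functions;
    they equal \<open>b\<close> itself, and not just on \<open>{1..n}\<close>, because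
    \<open>b\<close> is extensional.\<close>
  have eq: "(\<lambda>j\<in>{1..n}. F j) = b" if "\<And>j. j \<in> {1..n} \<Longrightarrow> F j = b j" for F
    using that PiE_ext[OF _ assms(3), of "\<lambda>j\<in>{1..n}. F j"] PiE_mem[OF assms(3)] by simp
  show ?thesis
    using assms(2) id_family_Arr[OF assms(1,3)] HomD[OF id_family_Hom[OF assms(1,3)]]
    by (auto simp: Hom_def Arr_mu_source intro!: eq)
      (auto simp: mu_source_def prod_cat_def family_cat_def intro!: eq)
qed

lemma whisker_Hom:
  assumes "g \<in> surjections k n" "k \<ge> 1" "\<gamma> \<in> Hom (OpCat P n) c c'" "b \<in> obj_families P k n g"
  shows "muA P k n g (\<gamma>, id_family P k n g b) \<in>
    Hom (OpCat P k) (muO P k n g (c, b)) (muO P k n g (c', b))"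
proof -
  interpret cat_functor "mu_source P k n g" "OpCat P k" "muO P k n g" "muA P k n g"
    using mu_functor'[OF assms(1,2)] .
  show ?thesis using FA_Hom[OF whisker_source_Hom[OF assms(1,3,4)]] .
qed

lemma whisker_Id:
  assumes "g \<in> surjections k n" "k \<ge> 1" "c \<in> Ob (OpCat P n)" "b \<in> obj_families P k n g"
  shows "muA P k n g (Id (OpCat P n) c, id_family P k n g b) = Id (OpCat P k) (muO P k n g (c, b))"
proof -
  interpret cat_functor "mu_source P k n g" "OpCat P k" "muO P k n g" "muA P k n g"
    using mu_functor'[OF assms(1,2)] .
  show ?thesis using FA_Id[of "(c, b)"] assms(3,4) by (simp add: Ob_mu_source Id_mu_source)
qed

text \<open>Identities are idempotent, so composing in \<open>mu_source\<close> leaves the family of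
  identities unchanged and functoriality applies to the first argument alone.\<close>

lemma whisker_Comp:
  assumes "g \<in> surjections k n" "k \<ge> 1" "b \<in> obj_families P k n g"
    and "\<gamma> \<in> Hom (OpCat P n) c c'" "\<gamma>' \<in> Hom (OpCat P n) c' c''"
  shows "muA P k n g (Comp (OpCat P n) \<gamma>' \<gamma>, id_family P k n g b) =
    Comp (OpCat P k) (muA P k n g (\<gamma>', id_family P k n g b)) (muA P k n g (\<gamma>, id_family P k n g b))"
proof -
  interpret cat_functor "mu_source P k n g" "OpCat P k" "muO P k n g" "muA P k n g"
    using mu_functor'[OF assms(1,2)] .
  have "Comp (OpCat P (fibre_size k g j)) (Id (OpCat P (fibre_size k g j)) (b j))
      (Id (OpCat P (fibre_size k g j)) (b j)) = Id (OpCat P (fibre_size k g j)) (b j)"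
    if "j \<in> {1..n}" for j
    using category.Comp_Id[OF fibre_category[OF assms(1) that]] id_family_Hom[OF assms(1,3) that] that
    by (simp add: id_family_def)
  then have "Comp (mu_source P k n g) (\<gamma>', id_family P k n g b) (\<gamma>, id_family P k n g b) =
      (Comp (OpCat P n) \<gamma>' \<gamma>, id_family P k n g b)"
    by (simp add: mu_source_def prod_cat_def family_cat_def id_family_def cong: restrict_cong)
  then show ?thesis
    using FA_Comp[OF whisker_source_Hom[OF assms(1,4,3)] whisker_source_Hom[OF assms(1,5,3)]]
    by simp
qed

lemma block_obj_families:
  assumes "f \<in> surjections m k" "g \<in> surjections k n" "a \<in> obj_families P m k f"
  shows "block k g a i \<in> obj_families P (fibre_size m (compose {1..m} g f) i) (fibre_size k g i)
    (induced m k f g i)"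
  using block_PiE[OF assms(1,2), of a "\<lambda>x. Ob (OpCat P x)" i] assms(3) .

text \<open>The identities on the two sides are taken in the same categories by
  \<open>fibre_size_induced\<close>.\<close>

lemma block_id_family:
  assumes "f \<in> surjections m k" "g \<in> surjections k n"
  shows "block k g (id_family P m k f a) i =
    id_family P (fibre_size m (compose {1..m} g f) i) (fibre_size k g i) (induced m k f g i)
      (block k g a i)"
  unfolding block_def id_family_def
proof (rule restrict_ext)
  fix j assume j: "j \<in> {1..fibre_size k g i}"
  show "(\<lambda>j\<in>{1..k}. Id (OpCat P (fibre_size m f j)) (a j)) (offset k g i + j) =
      Id (OpCat P (fibre_size (fibre_size m (compose {1..m} g f) i) (induced m k f g i) j))
        ((\<lambda>j\<in>{1..fibre_size k g i}. a (offset k g i + j)) j)"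
    using j offset_fibre(1)[OF assms(2) j] fibre_size_induced[OF assms j]
    by (simp only: restrict_apply')
qed

lemma block_mu_obj_families:
  assumes f: "f \<in> surjections m k" and g: "g \<in> surjections k n"
    and b: "b \<in> obj_families P k n g" and a: "a \<in> obj_families P m k f"
  shows "block_mu P m k n f g b a \<in> obj_families P m n (compose {1..m} g f)"
proof (rule PiE_I)
  fix i assume i: "i \<in> {1..n}"
  show "block_mu P m k n f g b a i \<in> Ob (OpCat P (fibre_size m (compose {1..m} g f) i))"
    using muO_Ob[OF induced_surjections[OF f g] fibre_size_pos[OF surjections_compose[OF f g] i]
        PiE_mem[OF b i] block_obj_families[OF f g a]] i
    by (simp add: block_mu_def)
qed (auto simp: block_mu_def)

lemma muO_assoc:
  assumes f: "f \<in> surjections m k" and g: "g \<in> surjections k n" and m: "m \<ge> 1"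
    and c: "c \<in> Ob (OpCat P n)" and b: "b \<in> obj_families P k n g" and a: "a \<in> obj_families P m k f"
  shows "muO P m k f (muO P k n g (c, b), a) =
    muO P m n (compose {1..m} g f) (c, block_mu P m k n f g b a)"
  unfolding block_mu_def
  using assoc_Ob[OF _ _ m f g _ a, of c b] surjections_pos_iff[OF f] surjections_pos_iff[OF g] m b c
  by (simp add: Ob_mu_source)

text \<open>Operad associativity on morphisms yields a family of \<mu>-values of identities;
  functoriality makes each of them an identity, so two successive whiskerings become one, along the
  composite.\<close>

lemma whisker_assoc:
  assumes f: "f \<in> surjections m k" and g: "g \<in> surjections k n" and m: "m \<ge> 1"
    and \<gamma>: "\<gamma> \<in> Arr (OpCat P n)" and b: "b \<in> obj_families P k n g" and a: "a \<in> obj_families P m k f"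
  shows "muA P m k f (muA P k n g (\<gamma>, id_family P k n g b), id_family P m k f a) =
    muA P m n (compose {1..m} g f)
      (\<gamma>, id_family P m n (compose {1..m} g f) (block_mu P m k n f g b a))"
proof -
  let ?gf = "compose {1..m} g f"
  have "muA P m k f (muA P k n g (\<gamma>, id_family P k n g b), id_family P m k f a) =
      muA P m n ?gf (\<gamma>, \<lambda>i\<in>{1..n}. muA P (fibre_size m ?gf i) (fibre_size k g i)
        (induced m k f g i) (id_family P k n g b i, block k g (id_family P m k f a) i))"
    using assoc_Arr[OF _ _ m f g _ id_family_Arr[OF f a]] surjections_pos_iff[OF f]
      surjections_pos_iff[OF g] m \<gamma> id_family_Arr[OF g b]
    by (simp add: Arr_mu_source)
  also have "(\<lambda>i\<in>{1..n}. muA P (fibre_size m ?gf i) (fibre_size k g i)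
        (induced m k f g i) (id_family P k n g b i, block k g (id_family P m k f a) i)) =
      id_family P m n ?gf (block_mu P m k n f g b a)"
    unfolding id_family_def[of P m n]
  proof (rule restrict_ext)
    fix i assume i: "i \<in> {1..n}"
    show "muA P (fibre_size m ?gf i) (fibre_size k g i)
        (induced m k f g i) (id_family P k n g b i, block k g (id_family P m k f a) i) =
      Id (OpCat P (fibre_size m ?gf i)) (block_mu P m k n f g b a i)"
      using whisker_Id[OF induced_surjections[OF f g]
          fibre_size_pos[OF surjections_compose[OF f g] i] PiE_mem[OF b i]
          block_obj_families[OF f g a]] i
      by (simp add: block_id_family[OF f g] block_mu_def id_family_def[of P k n])
  qed
  finally show ?thesis .
qed

text \<open>Operad associativity is applied in each fibre over \<open>i\<close> to the induced maps.
  The nested fibres and blocks that it produces are then identified with the direct ones. This is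
  associativity for the object components of one-cells.\<close>

lemma block_mu_assoc:
  assumes f: "f \<in> surjections m k" and g: "g \<in> surjections k n" and h: "h \<in> surjections n p"
    and c: "c \<in> obj_families P n p h" and b: "b \<in> obj_families P k n g"
    and a: "a \<in> obj_families P m k f"
  shows "block_mu P m n p (compose {1..m} g f) h c (block_mu P m k n f g b a) =
    block_mu P m k p f (compose {1..k} h g) (block_mu P k n p g h c b) a"
    (is "?l = ?r")
proof -
  let ?gf = "compose {1..m} g f" and ?hg = "compose {1..k} h g"
  let ?hgf = "compose {1..m} ?hg f"
  have eq: "compose {1..m} h ?gf = ?hgf"
    by (rule surjections_compose_assoc[OF f, symmetric])
  note hg = surjections_compose[OF g h] and hgf = surjections_compose[OF f surjections_compose[OF g h]]
  show ?thesis
  proof (rule extensionalityI)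
    show "?l \<in> extensional {1..p}" "?r \<in> extensional {1..p}"
      by (simp_all add: block_mu_def)
    fix i assume i: "i \<in> {1..p}"
    let ?mi = "fibre_size m ?hgf i" and ?ki = "fibre_size k ?hg i" and ?ni = "fibre_size n h i"
    let ?fi = "induced m k f ?hg i" and ?gi = "induced k n g h i"
    have comp: "compose {1..?mi} ?gi ?fi = induced m n ?gf h i"
      by (rule induced_compose[OF f g h])
    have "?r i = muO P ?mi ?ki ?fi (muO P ?ki ?ni ?gi (c i, block n h b i), block k ?hg a i)"
      using i by (simp add: block_mu_def)
    \<comment> \<open>Operad associativity for the maps induced by \<open>f\<close> and
      \<open>g\<close> over \<open>i\<close>; the fibre \<open>?mi\<close> is nonempty because
      \<open>i\<close> lies in the range of a surjection.\<close>
    also have "\<dots> = muO P ?mi ?ni (compose {1..?mi} ?gi ?fi)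
        (c i, block_mu P ?mi ?ki ?ni ?fi ?gi (block n h b i) (block k ?hg a i))"
      by (rule muO_assoc[OF induced_surjections[OF f hg] induced_surjections[OF g h]
            fibre_size_pos[OF hgf i] PiE_mem[OF c i] block_obj_families[OF g h b]
            block_obj_families[OF f hg a]])
    \<comment> \<open>Passing from the local coordinate \<open>j\<close> over \<open>i\<close> to
      the global point \<open>offset n h i + j\<close> turns every nested ingredient into the
      corresponding direct one.\<close>
    also have "block_mu P ?mi ?ki ?ni ?fi ?gi (block n h b i) (block k ?hg a i) =
        block n h (block_mu P m k n f g b a) i"
      unfolding block_mu_def[of P ?mi] block_def[of n h "block_mu P m k n f g b a"]
    proof (rule restrict_ext)
      fix j assume j: "j \<in> {1..?ni}"
      let ?j = "offset n h i + j"
      have "fibre_size ?mi (compose {1..?mi} ?gi ?fi) j = fibre_size m ?gf ?j"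
        using fibre_size_induced[OF surjections_compose[OF f g] h j] by (simp only: comp eq)
      moreover have "block n h b i j = b ?j"
        using j by (simp add: block_def)
      ultimately show "muO P (fibre_size ?mi (compose {1..?mi} ?gi ?fi) j) (fibre_size ?ki ?gi j)
          (induced ?mi ?ki ?fi ?gi j) (block n h b i j, block ?ki ?gi (block k ?hg a i) j) =
        block_mu P m k n f g b a ?j"
        using offset_fibre(1)[OF h j]
        by (simp only: fibre_size_induced[OF g h j] induced_induced[OF f g h j]
            block_block[OF g h j] block_mu_def restrict_apply')
    qed
    finally show "?l i = ?r i"
      using i by (simp only: comp block_mu_def[of P m n] eq restrict_apply')
  qed
qed

section \<open>Units and the object components of one-cells\<close>

lemma id_family_unit:
  "id_family P m m (ord_id m) (\<lambda>i\<in>{1..m}. OpUnit P) = (\<lambda>i\<in>{1..m}. Id (OpCat P 1) (OpUnit P))"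
  unfolding id_family_def by (rule restrict_ext) (simp add: fibre_size_ord_id)

lemma unit_obj_families: "(\<lambda>i\<in>{1..m}. OpUnit P) \<in> obj_families P m m (ord_id m)"
  using unit_Ob by (auto simp: fibre_size_ord_id)

text \<open>Over each \<open>i\<close> the entry is \<mu> along \<open>ord_bang\<close> applied to
  the unit and \<open>a i\<close>, so the left unit law applies.\<close>

lemma block_mu_unit_left:
  assumes f: "f \<in> surjections m k" and a: "a \<in> obj_families P m k f"
  shows "block_mu P m k k f (ord_id k) (\<lambda>i\<in>{1..k}. OpUnit P) a = a"
proof (rule extensionalityI)
  show "block_mu P m k k f (ord_id k) (\<lambda>i\<in>{1..k}. OpUnit P) a \<in> extensional {1..k}"
    by (simp add: block_mu_def)
  show "a \<in> extensional {1..k}" using a by (simp add: PiE_def)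
  show "block_mu P m k k f (ord_id k) (\<lambda>i\<in>{1..k}. OpUnit P) a i = a i" if i: "i \<in> {1..k}" for i
    using left_unit_Ob[OF fibre_size_pos[OF f i] PiE_mem[OF a i]] i
    by (simp only: block_mu_def compose_ord_id_left[OF f] induced_ord_id_left[OF f i]
        block_ord_id[OF i] fibre_size_ord_id[OF i] restrict_apply')
qed

text \<open>Over each \<open>i\<close> the entry is \<mu> along an identity applied to
  \<open>a i\<close> and units, so the right unit law applies.\<close>

lemma block_mu_unit_right:
  assumes f: "f \<in> surjections m k" and a: "a \<in> obj_families P m k f"
  shows "block_mu P m m k (ord_id m) f a (\<lambda>i\<in>{1..m}. OpUnit P) = a"
proof (rule extensionalityI)
  show "block_mu P m m k (ord_id m) f a (\<lambda>i\<in>{1..m}. OpUnit P) \<in> extensional {1..k}"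
    by (simp add: block_mu_def)
  show "a \<in> extensional {1..k}" using a by (simp add: PiE_def)
  show "block_mu P m m k (ord_id m) f a (\<lambda>i\<in>{1..m}. OpUnit P) i = a i" if i: "i \<in> {1..k}" for i
    using right_unit_Ob[OF fibre_size_pos[OF f i] PiE_mem[OF a i]] i
    by (simp only: block_mu_def compose_ord_id_right[OF f] induced_ord_id_right[OF f]
        block_const[OF f] restrict_apply')
qed

end

section \<open>The category of one-cells\<close>

lemma int_Ob_iff: "(m, x) \<in> int_Ob P \<longleftrightarrow> m \<ge> 1 \<and> x \<in> Ob (OpCat P m)"
  by (simp add: int_Ob_def)

lemma int_Arr_iff:
  "OneCell (m, x) (k, b) f a \<alpha> \<in> int_Arr P \<longleftrightarrow>
    m \<ge> 1 \<and> x \<in> Ob (OpCat P m) \<and> k \<ge> 1 \<and> b \<in> Ob (OpCat P k) \<and> f \<in> surjections m k \<and>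
    a \<in> obj_families P m k f \<and> \<alpha> \<in> Hom (OpCat P m) (muO P m k f (b, a)) x"
  by (auto simp: int_Arr_def int_Ob_def)

lemma int_Comp_eq:
  "int_Comp P (OneCell (k, y) (n, z) g b \<beta>) (OneCell (m, x) t f a \<alpha>) =
    OneCell (m, x) (n, z) (compose {1..m} g f) (block_mu P m k n f g b a)
      (Comp (OpCat P m) \<alpha> (muA P m k f (\<beta>, id_family P m k f a)))"
  by (simp add: Let_def block_mu_def id_family_def)

text \<open>From here on composites are expanded by \<open>int_Comp_eq\<close>, so that the results
  on \<open>block_mu\<close> and \<open>id_family\<close> match.\<close>

declare int_Comp.simps [simp del]

text \<open>Families of objects are extensional, so having all entries equal to the unit determines
  the family.\<close>

lemma int_E_iff:
  "OneCell (m, x) (k, b) f a \<alpha> \<in> int_E P \<longleftrightarrow>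
    OneCell (m, x) (k, b) f a \<alpha> \<in> int_Arr P \<and> k = m \<and> f = ord_id m \<and> a = (\<lambda>i\<in>{1..m}. OpUnit P)"
proof -
  have "(\<forall>i\<in>{1..k}. a i = OpUnit P) \<longleftrightarrow> a = (\<lambda>i\<in>{1..k}. OpUnit P)"
    if "OneCell (m, x) (k, b) f a \<alpha> \<in> int_Arr P"
    using that by (auto simp: int_Arr_iff PiE_def intro: extensionalityI)
  then show ?thesis by (auto simp: int_E_def int_cat_def)
qed

lemma int_M_iff:
  "OneCell (m, x) (k, b) f a \<alpha> \<in> int_M P \<longleftrightarrow>
    OneCell (m, x) (k, b) f a \<alpha> \<in> int_Arr P \<and> (\<exists>y \<in> Ob (OpCat P m). \<alpha> = Id (OpCat P m) y)"
  by (auto simp: int_M_def int_cat_def)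

lemma onecell_exhaust:
  obtains m x k b f a \<alpha> where "p = OneCell (m, x) (k, b) f a \<alpha>"
  by (metis onecell.exhaust surj_pair)

section \<open>Category axioms for one-cells\<close>

context ns_cat_operad
begin

lemma int_Id_E: "(m, x) \<in> int_Ob P \<Longrightarrow> int_Id P (m, x) \<in> int_E P"
  using ord_id_surjections[of m] unit_obj_families[of m] category.Id_Hom[OF category[of m]]
  by (auto simp: int_E_iff int_Arr_iff int_Ob_iff right_unit_Ob)

lemma int_Id_M: "(m, x) \<in> int_Ob P \<Longrightarrow> int_Id P (m, x) \<in> int_M P"
  using int_Id_E[of m x] by (auto simp: int_E_iff int_M_iff int_Ob_iff)

text \<open>Whiskering \<open>\<beta>\<close> gives a morphism out of a nested \<mu>, whereas a
  one-cell over the composite map must start at a single \<mu>; \<open>muO_assoc\<close> identifies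
  the two objects.\<close>

lemma int_Comp_Arr:
  assumes p: "OneCell (m, x) (k, y) f a \<alpha> \<in> int_Arr P"
    and q: "OneCell (k, y) (n, z) g b \<beta> \<in> int_Arr P"
  shows "int_Comp P (OneCell (k, y) (n, z) g b \<beta>) (OneCell (m, x) (k, y) f a \<alpha>) \<in> int_Arr P"
proof -
  note p = p[unfolded int_Arr_iff] and q = q[unfolded int_Arr_iff]
  have "muA P m k f (\<beta>, id_family P m k f a) \<in>
      Hom (OpCat P m) (muO P m k f (muO P k n g (z, b), a)) (muO P m k f (y, a))"
    using whisker_Hom p q by blast
  then have "Comp (OpCat P m) \<alpha> (muA P m k f (\<beta>, id_family P m k f a)) \<in>
      Hom (OpCat P m) (muO P m k f (muO P k n g (z, b), a)) x"
    using category.Comp_Hom[OF category] p by blast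
  moreover have "muO P m k f (muO P k n g (z, b), a) =
      muO P m n (compose {1..m} g f) (z, block_mu P m k n f g b a)"
    using muO_assoc p q by blast
  ultimately show ?thesis
    using p q surjections_compose block_mu_obj_families by (auto simp: int_Comp_eq int_Arr_iff)
qed

text \<open>The right unit laws erase the inner cell up to \<open>x\<close> and
  \<open>\<alpha>\<close>. Right identities, closure of \<open>int_E\<close>, and existence and
  uniqueness of factorizations all rest on this computation.\<close>

lemma int_Comp_E_right:
  assumes q: "OneCell (m, y) (k, b) f a \<beta> \<in> int_Arr P"
  shows "int_Comp P (OneCell (m, y) (k, b) f a \<beta>)
      (OneCell (m, x) t (ord_id m) (\<lambda>i\<in>{1..m}. OpUnit P) \<alpha>) =
    OneCell (m, x) (k, b) f a (Comp (OpCat P m) \<alpha> \<beta>)"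
  using q right_unit_Arr[of m \<beta>] HomD[of \<beta> "OpCat P m"]
  by (auto simp: int_Arr_iff int_Comp_eq compose_ord_id_right block_mu_unit_right id_family_unit)

lemma int_Comp_Id:
  assumes q: "OneCell (m, y) (k, b) f a \<beta> \<in> int_Arr P"
  shows "int_Comp P (OneCell (m, y) (k, b) f a \<beta>) (int_Id P (m, y)) = OneCell (m, y) (k, b) f a \<beta>"
  using q category.Id_Comp[OF category[of m]]
  by (auto simp: int_Comp_E_right int_Arr_iff)

lemma int_Id_Comp:
  assumes p: "OneCell (m, x) (k, y) f a \<alpha> \<in> int_Arr P"
  shows "int_Comp P (int_Id P (k, y)) (OneCell (m, x) (k, y) f a \<alpha>) = OneCell (m, x) (k, y) f a \<alpha>"
proof -
  note p = p[unfolded int_Arr_iff]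
  have "Comp (OpCat P m) \<alpha> (muA P m k f (Id (OpCat P k) y, id_family P m k f a)) = \<alpha>"
    using category.Comp_Id[OF category, of m \<alpha> _ x] p by (auto simp: whisker_Id)
  then show ?thesis
    using p by (simp add: int_Comp_eq compose_ord_id_left block_mu_unit_left)
qed

text \<open>For the last components, \<mu> along \<open>f\<close> is distributed over the composite
  of \<open>\<beta>\<close> with the whiskered \<open>\<gamma>\<close>, the result is rebracketed in
  \<open>OpCat P l\<close>, and \<open>whisker_assoc\<close> merges the double whiskering of
  \<open>\<gamma>\<close>.\<close>

lemma int_Comp_assoc:
  assumes p: "OneCell (l, w) (m, x) f a \<alpha> \<in> int_Arr P"
    and q: "OneCell (m, x) (k, y) g b \<beta> \<in> int_Arr P"
    and r: "OneCell (k, y) (n, z) h c \<gamma> \<in> int_Arr P"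
  shows "int_Comp P (OneCell (k, y) (n, z) h c \<gamma>)
      (int_Comp P (OneCell (m, x) (k, y) g b \<beta>) (OneCell (l, w) (m, x) f a \<alpha>)) =
    int_Comp P (int_Comp P (OneCell (k, y) (n, z) h c \<gamma>) (OneCell (m, x) (k, y) g b \<beta>))
      (OneCell (l, w) (m, x) f a \<alpha>)"
proof -
  have l: "l \<ge> 1" and m: "m \<ge> 1"
    and f: "f \<in> surjections l m" and g: "g \<in> surjections m k" and h: "h \<in> surjections k n"
    and a: "a \<in> obj_families P l m f" and b: "b \<in> obj_families P m k g"
    and c: "c \<in> obj_families P k n h"
    and \<alpha>: "\<alpha> \<in> Hom (OpCat P l) (muO P l m f (x, a)) w"
    and \<beta>: "\<beta> \<in> Hom (OpCat P m) (muO P m k g (y, b)) x"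
    and \<gamma>: "\<gamma> \<in> Hom (OpCat P k) (muO P k n h (z, c)) y"
    using p q r by (simp_all add: int_Arr_iff)
  let ?g\<gamma> = "muA P m k g (\<gamma>, id_family P m k g b)"
  let ?f = "\<lambda>\<phi>. muA P l m f (\<phi>, id_family P l m f a)"
  note g\<gamma> = whisker_Hom[OF g m \<gamma> b]
  have f\<gamma>: "?f ?g\<gamma> = muA P l k (compose {1..l} g f)
      (\<gamma>, id_family P l k (compose {1..l} g f) (block_mu P l m k f g b a))"
    using whisker_assoc[OF f g l _ b a] HomD[OF \<gamma>] by blast
  have "?f (Comp (OpCat P m) \<beta> ?g\<gamma>) = Comp (OpCat P l) (?f \<beta>) (?f ?g\<gamma>)"
    by (rule whisker_Comp[OF f l a g\<gamma> \<beta>])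
  moreover have "Comp (OpCat P l) \<alpha> (Comp (OpCat P l) (?f \<beta>) (?f ?g\<gamma>)) =
      Comp (OpCat P l) (Comp (OpCat P l) \<alpha> (?f \<beta>)) (?f ?g\<gamma>)"
    by (rule category.Comp_assoc[OF category[OF l] whisker_Hom[OF f l g\<gamma> a]
          whisker_Hom[OF f l \<beta> a] \<alpha>])
  moreover note surjections_compose_assoc[OF f, of h g] block_mu_assoc[OF f g h c b a]
  ultimately show ?thesis
    by (simp add: int_Comp_eq f\<gamma>)
qed

lemma int_Hom_cases:
  assumes "p \<in> Hom (int_cat P) u v"
  obtains m x k y f a \<alpha> where "u = (m, x)" "v = (k, y)" "p = OneCell (m, x) (k, y) f a \<alpha>"
    "OneCell (m, x) (k, y) f a \<alpha> \<in> int_Arr P"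
  using assms by (cases p rule: onecell_exhaust) (auto simp: Hom_def int_cat_def)

lemma int_category: "Defs.category (int_cat P)"
proof
  fix p assume "p \<in> Arr (int_cat P)"
  then show "Dom (int_cat P) p \<in> Ob (int_cat P)" "Cod (int_cat P) p \<in> Ob (int_cat P)"
    by (auto simp: int_cat_def int_Arr_def)
next
  fix u assume "u \<in> Ob (int_cat P)"
  then show "Id (int_cat P) u \<in> Hom (int_cat P) u u"
    using int_Id_E by (cases u) (auto simp: int_cat_def Hom_def int_E_iff)
next
  fix p q u v w assume p: "p \<in> Hom (int_cat P) u v" and q: "q \<in> Hom (int_cat P) v w"
  show "Comp (int_cat P) q p \<in> Hom (int_cat P) u w"
  proof (cases rule: int_Hom_cases[OF p]; cases rule: int_Hom_cases[OF q])
    fix m x k y f a \<alpha> k' y' n z g b \<beta>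
    assume *: "u = (m, x)" "v = (k, y)" "p = OneCell (m, x) (k, y) f a \<alpha>"
      "OneCell (m, x) (k, y) f a \<alpha> \<in> int_Arr P" "v = (k', y')" "w = (n, z)"
      "q = OneCell (k', y') (n, z) g b \<beta>" "OneCell (k', y') (n, z) g b \<beta> \<in> int_Arr P"
    then show ?thesis
      using int_Comp_Arr[of m x k y f a \<alpha> n z g b \<beta>] by (simp add: int_cat_def Hom_def int_Comp_eq)
  qed
next
  fix p u v assume p: "p \<in> Hom (int_cat P) u v"
  show "Comp (int_cat P) p (Id (int_cat P) u) = p" "Comp (int_cat P) (Id (int_cat P) v) p = p"
    using int_Comp_Id int_Id_Comp
    by (cases rule: int_Hom_cases[OF p]; simp add: int_cat_def del: int_Id.simps)+
next
  fix p q r u v w z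
  assume p: "p \<in> Hom (int_cat P) u v" and q: "q \<in> Hom (int_cat P) v w"
    and r: "r \<in> Hom (int_cat P) w z"
  show "Comp (int_cat P) r (Comp (int_cat P) q p) = Comp (int_cat P) (Comp (int_cat P) r q) p"
    using int_Comp_assoc
    by (cases rule: int_Hom_cases[OF p]; cases rule: int_Hom_cases[OF q];
        cases rule: int_Hom_cases[OF r]) (simp add: int_cat_def)
qed

section \<open>The two wide subcategories\<close>

lemma wide_int_E: "wide_subcategory (int_cat P) (int_E P)"
proof -
  have comp: "int_Comp P q p \<in> int_E P" if p: "p \<in> int_E P" and q: "q \<in> int_E P" and "tgt p = src q" for p q
  proof (cases p rule: onecell_exhaust; cases q rule: onecell_exhaust)
    fix m x k b f a \<alpha> m' x' k' b' f' a' \<alpha>'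
    assume *: "p = OneCell (m, x) (k, b) f a \<alpha>" "q = OneCell (m', x') (k', b') f' a' \<alpha>'"
    \<comment> \<open>The composite inherits its map and its objects from the outer factor
      \<open>q\<close>, which has the identity and units there.\<close>
    then show ?thesis
      using that int_Comp_Arr[of m x k b f a \<alpha> k' b' f' a' \<alpha>'] int_Comp_E_right[of m b k' b' f' a' \<alpha>' x "(k, b)" \<alpha>]
      by (auto simp: int_E_iff)
  qed
  then show ?thesis
    using int_Id_E unfolding wide_subcategory_def
    by (auto simp: int_cat_def int_E_def simp del: int_Id.simps)
qed

text \<open>An identity has equal domain and codomain, so the object allowed by \<open>int_M\<close>
  is forced to be both the \<mu>-value and the source object. This is what pins down the middle
  object of a factorization.\<close>

lemma int_M_mor:
  assumes "OneCell (m, x) (k, b) f a \<alpha> \<in> int_M P"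
  shows "x = muO P m k f (b, a)" "\<alpha> = Id (OpCat P m) x"
proof -
  obtain y where y: "y \<in> Ob (OpCat P m)" "\<alpha> = Id (OpCat P m) y"
    using assms by (auto simp: int_M_iff)
  have "m \<ge> 1" and \<alpha>: "\<alpha> \<in> Hom (OpCat P m) (muO P m k f (b, a)) x"
    using assms by (auto simp: int_M_iff int_Arr_iff)
  then have "\<alpha> \<in> Hom (OpCat P m) y y"
    using y category.Id_Hom[OF category] by simp
  with \<alpha> y show "x = muO P m k f (b, a)" "\<alpha> = Id (OpCat P m) x"
    by (auto simp: Hom_def)
qed

lemma int_Comp_M:
  assumes p: "OneCell (m, x) (k, y) f a \<alpha> \<in> int_M P" and q: "OneCell (k, y) (n, z) g b \<beta> \<in> int_M P"
  shows "int_Comp P (OneCell (k, y) (n, z) g b \<beta>) (OneCell (m, x) (k, y) f a \<alpha>) \<in> int_M P"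
proof -
  have arr: "OneCell (m, x) (k, y) f a \<alpha> \<in> int_Arr P" "OneCell (k, y) (n, z) g b \<beta> \<in> int_Arr P"
    using p q by (simp_all add: int_M_iff)
  note p' = arr(1)[unfolded int_Arr_iff]
  \<comment> \<open>Here \<open>\<beta>\<close> is the identity of \<open>y\<close>, so the
    whiskering is an identity; its object, a \<mu>-value, is \<open>x\<close> because the inner cell
    lies in \<open>int_M\<close>.\<close>
  have "muA P m k f (\<beta>, id_family P m k f a) = Id (OpCat P m) x"
    using p' whisker_Id int_M_mor[OF p] int_M_mor[OF q] by simp
  moreover have "Comp (OpCat P m) (Id (OpCat P m) x) (Id (OpCat P m) x) = Id (OpCat P m) x"
    using category.Comp_Id[OF category] category.Id_Hom[OF category] p' by blast
  ultimately have "Comp (OpCat P m) \<alpha> (muA P m k f (\<beta>, id_family P m k f a)) = Id (OpCat P m) x"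
    using int_M_mor(2)[OF p] by simp
  then show ?thesis
    using int_Comp_Arr[OF arr] p' by (auto simp: int_Comp_eq int_M_iff)
qed

lemma wide_int_M: "wide_subcategory (int_cat P) (int_M P)"
proof -
  have comp: "int_Comp P q p \<in> int_M P" if "p \<in> int_M P" "q \<in> int_M P" "tgt p = src q" for p q
    using that int_Comp_M
    by (cases p rule: onecell_exhaust; cases q rule: onecell_exhaust) (auto)
  then show ?thesis
    using int_Id_M unfolding wide_subcategory_def
    by (auto simp: int_cat_def int_M_def simp del: int_Id.simps)
qed

section \<open>Existence and uniqueness of the factorization\<close>

lemma factorization_exists:
  assumes r: "OneCell (m, x) (k, b) f a \<alpha> \<in> int_Arr P"
  defines "y \<equiv> muO P m k f (b, a)"
  defines "p \<equiv> OneCell (m, x) (m, y) (ord_id m) (\<lambda>i\<in>{1..m}. OpUnit P) \<alpha>"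
    and "q \<equiv> OneCell (m, y) (k, b) f a (Id (OpCat P m) y)"
  shows "p \<in> int_E P" "q \<in> int_M P" "int_Comp P q p = OneCell (m, x) (k, b) f a \<alpha>"
proof -
  note r = r[unfolded int_Arr_iff]
  \<comment> \<open>The middle object is the domain of \<open>\<alpha>\<close>: this admits an
    identity as last component of \<open>q\<close>, and the right unit law lets
    \<open>\<alpha>\<close> serve as last component of \<open>p\<close>.\<close>
  have y: "y \<in> Ob (OpCat P m)"
    using r muO_Ob by (simp add: y_def)
  have \<alpha>: "\<alpha> \<in> Hom (OpCat P m) y x" using r by (simp add: y_def)
  show "p \<in> int_E P"
    using r y \<alpha> ord_id_surjections unit_obj_families[of m]
    by (auto simp: p_def int_E_iff int_Arr_iff right_unit_Ob)
  have q: "q \<in> int_Arr P"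
    using r y category.Id_Hom[OF category] by (simp add: q_def int_Arr_iff y_def)
  then show "q \<in> int_M P"
    using y by (auto simp: q_def int_M_iff)
  show "int_Comp P q p = OneCell (m, x) (k, b) f a \<alpha>"
    using category.Comp_Id[OF category \<alpha>] r int_Comp_E_right[OF q[unfolded q_def]]
    by (simp add: p_def q_def)
qed

text \<open>The last component of \<open>q\<close> is an identity, so the composite carries the map,
  objects and target of \<open>q\<close> together with the source and last component of
  \<open>p\<close>. Every component of both factors can be read off, the middle object by
  \<open>int_M_mor\<close>.\<close>

lemma factorization_unique:
  assumes p: "p \<in> int_E P" and q: "q \<in> int_M P" and pq: "tgt p = src q"
    and r: "int_Comp P q p = OneCell (m, x) (k, b) f a \<alpha>"
  shows "p = OneCell (m, x) (m, muO P m k f (b, a)) (ord_id m) (\<lambda>i\<in>{1..m}. OpUnit P) \<alpha>"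
    and "q = OneCell (m, muO P m k f (b, a)) (k, b) f a (Id (OpCat P m) (muO P m k f (b, a)))"
proof -
  obtain m' x' k' y' f' a' \<alpha>' where p': "p = OneCell (m', x') (k', y') f' a' \<alpha>'"
    by (rule onecell_exhaust)
  then have p_eq: "p = OneCell (m', x') (m', y') (ord_id m') (\<lambda>i\<in>{1..m'}. OpUnit P) \<alpha>'"
    and p_arr: "OneCell (m', x') (m', y') (ord_id m') (\<lambda>i\<in>{1..m'}. OpUnit P) \<alpha>' \<in> int_Arr P"
    using p by (auto simp: int_E_iff)
  then obtain n c g e \<beta> where q': "q = OneCell (m', y') (n, c) g e \<beta>"
    using pq by (cases q rule: onecell_exhaust) auto
  note q_mor = int_M_mor[OF q[unfolded q']]
  have q_arr: "OneCell (m', y') (n, c) g e \<beta> \<in> int_Arr P"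
    using q by (simp add: q' int_M_iff)
  have \<alpha>': "m' \<ge> 1" "\<alpha>' \<in> Hom (OpCat P m') y' x'"
    using p_arr by (auto simp: int_Arr_iff right_unit_Ob)
  have "Comp (OpCat P m') \<alpha>' \<beta> = \<alpha>'"
    using category.Comp_Id[OF category \<alpha>'(2)] \<alpha>'(1) q_mor(2) by simp
  \<comment> \<open>Injectivity of the constructor now matches all components at once.\<close>
  then have "OneCell (m, x) (k, b) f a \<alpha> = OneCell (m', x') (n, c) g e \<alpha>'"
    using r int_Comp_E_right[OF q_arr] by (simp add: p_eq q')
  then show "p = OneCell (m, x) (m, muO P m k f (b, a)) (ord_id m) (\<lambda>i\<in>{1..m}. OpUnit P) \<alpha>"
    and "q = OneCell (m, muO P m k f (b, a)) (k, b) f a (Id (OpCat P m) (muO P m k f (b, a)))"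
    using q_mor p_eq q' by auto
qed

lemma int_strict_factorization_system:
  "strict_factorization_system (int_cat P) (int_E P) (int_M P)"
  unfolding strict_factorization_system_def
proof (intro conjI ballI int_category wide_int_E wide_int_M)
  fix r assume r: "r \<in> Arr (int_cat P)"
  obtain m x k b f a \<alpha> where r_eq: "r = OneCell (m, x) (k, b) f a \<alpha>"
    by (rule onecell_exhaust)
  then have "OneCell (m, x) (k, b) f a \<alpha> \<in> int_Arr P" using r by (simp add: int_cat_def)
  note ex = factorization_exists[OF this]
  let ?y = "muO P m k f (b, a)"
  show "\<exists>!(p, q). p \<in> int_E P \<and> q \<in> int_M P \<and> Cod (int_cat P) p = Dom (int_cat P) q \<and>
      r = Comp (int_cat P) q p"
  proof (rule ex1I[of _ "(OneCell (m, x) (m, ?y) (ord_id m) (\<lambda>i\<in>{1..m}. OpUnit P) \<alpha>,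
        OneCell (m, ?y) (k, b) f a (Id (OpCat P m) ?y))"])
    show "case (OneCell (m, x) (m, ?y) (ord_id m) (\<lambda>i\<in>{1..m}. OpUnit P) \<alpha>,
        OneCell (m, ?y) (k, b) f a (Id (OpCat P m) ?y)) of (p, q) \<Rightarrow>
      p \<in> int_E P \<and> q \<in> int_M P \<and> Cod (int_cat P) p = Dom (int_cat P) q \<and> r = Comp (int_cat P) q p"
      using ex by (simp add: int_cat_def r_eq)
  next
    fix pq
    assume "case pq of (p, q) \<Rightarrow>
      p \<in> int_E P \<and> q \<in> int_M P \<and> Cod (int_cat P) p = Dom (int_cat P) q \<and> r = Comp (int_cat P) q p"
    then show "pq = (OneCell (m, x) (m, ?y) (ord_id m) (\<lambda>i\<in>{1..m}. OpUnit P) \<alpha>,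
        OneCell (m, ?y) (k, b) f a (Id (OpCat P m) ?y))"
      using factorization_unique(1)[of "fst pq" "snd pq" m x k b f a \<alpha>]
        factorization_unique(2)[of "fst pq" "snd pq" m x k b f a \<alpha>]
      unfolding int_cat_def r_eq by (auto simp: case_prod_beta intro!: prod_eqI)
  qed
qed

end

theorem proposition2p9:
  fixes P :: "('o, 'a) operad"
  assumes "ns_cat_operad P"
  shows "strict_factorization_system (int_cat P) (int_E P) (int_M P) \<and>
    (\<forall>m x k b f a \<alpha>. OneCell (m, x) (k, b) f a \<alpha> \<in> Arr (int_cat P) \<longrightarrow>
      (let y = muO P m k f (b, a);
           p = OneCell (m, x) (m, y) (ord_id m) (\<lambda>i\<in>{1..m}. OpUnit P) \<alpha>;
           q = OneCell (m, y) (k, b) f a (Id (OpCat P m) y)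
       in p \<in> int_E P \<and> q \<in> int_M P \<and> Cod (int_cat P) p = Dom (int_cat P) q \<and>
          OneCell (m, x) (k, b) f a \<alpha> = Comp (int_cat P) q p))"
proof -
  interpret ns_cat_operad P by fact
  show ?thesis
    using int_strict_factorization_system factorization_exists
    by (simp add: int_cat_def Let_def)
qed

end
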